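(* Let $(\mathcal{A},\varphi,\varphi')$ be an infinitesimal probability space and $j\in\mathcal{A}$ an infinitesimal idempotent with $\varphi'(j)\ne0$; put $\psi(a)=\varphi'(aj)/\varphi'(j)$ for $a\in\mathcal{A}$. Suppose $(\mathcal{A}_i)_{i\in I}$ are unital subalgebras of $\mathcal{A}$ that are infinitesimally free from $j$. Then $(j\mathcal{J}(\mathcal{A}_i)j)_{i\in I}$ are Boolean independent with respect to $\psi$. If we further assume that $(\mathcal{A}_i)_{i\in I}$ are free, then $(\mathcal{J}_a(\mathcal{A}_i))_{i\in I}$ are Boolean independent with respect to $\psi$.
   Context: An infinitesimal probability space $(\mathcal{A},\varphi,\varphi')$ is a unital algebra $\mathcal{A}$ over $\mathbb{C}$ with linear functionals $\varphi,\varphi'$ such that $\varphi(1)=1$, $\varphi'(1)=0$. An infinitesimal idempotent is $j\in\mathcal{A}$ with $j^2=j$ and $\varphi(j^n)=0$ for all $n\ge1$. Unital subalgebras $(\mathcal{C}_i)$ are infinitesimally free if, whenever $a_k\in\mathcal{C}_{i_k}$ with consecutive indices distinct and $\varphi(a_k)=0$ for all $k$, one has $\varphi(a_1\cdots a_n)=0$ and $\varphi'(a_1\cdots a_n)=\sum_{k=1}^n\varphi'(a_k)\varphi(a_1\cdots a_{k-1}a_{k+1}\cdots a_n)$; they are free (with respect to $\varphi$) if, whenever $a_k\in\mathcal{C}_{i_k}$ with consecutive indices distinct and $\varphi(a_k)=0$ for all $k$, one has $\varphi(a_1\cdots a_n)=0$. That $(\mathcal{A}_i)_{i\in I}$ are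 infinitesimally free from $j$ means: the unital algebra generated by $\bigcup_i\mathcal{A}_i$ and the unital algebra generated by $j$ are infinitesimally free. (Not necessarily unital) subalgebras $(\mathcal{D}_i)_{i\in I}$ are Boolean independent with respect to $\psi$ if $\psi(x_1\cdots x_n)=\psi(x_1)\cdots\psi(x_n)$ whenever $x_k\in\mathcal{D}_{i_k}$ and $i_1\ne i_2\ne\cdots\ne i_n$ (consecutive indices distinct). Write $j^{(-1)}=j$, $j^{(1)}=j^\perp:=1-j$. For a unital subalgebra $\mathcal{B}\subseteq\mathcal{A}$, $\mathcal{J}(\mathcal{B})$ is the algebra generated by the words $j^{(\varepsilon_1)}a_1j^{(\varepsilon_2)}a_2\cdots j^{(\varepsilon_{k-1})}a_{k-1}j^{(\varepsilon_k)}$ with $k\ge0$, $\varepsilon_1,\dots,\varepsilon_k\in\{-1,1\}$ and $a_1,a_2,\dots,a_k\in\mathcal{B}$ (so for $k=1$ the word is $j^{(\varepsilon_1)}$). $\mathcal{J}_a(\mathcal{B})$ is the subalgebra of $\mathcal{J}(\mathcal{B})$ generated by those of these words for which $\varepsilon_1\neq\varepsilon_2\neq\cdots\neq\varepsilon_{k-1}\neq\varepsilon_k$ (consecutive signs distinct). $j\mathcal{J}(\mathcal{B})j=\{jxj:x\in\mathcal{J}(\mathcal{B})\}$.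
   Formalization: The generators of J_a(B) are the words with alternating signs except the empty word 1 and the one-letter word 1−j, for which the sign condition is vacuous; with either of them admitted, the second claim (Boolean independence of the J_a(A_i)) is false. *)

theory Defs
  imports Complex_Main "HOL.Hull"
begin

locale complex_algebra = vector_space scale
  for scale :: "complex \<Rightarrow> 'a::ring_1 \<Rightarrow> 'a" +
  assumes scale_mult_left: "scale c x * y = scale c (x * y)"
    and scale_mult_right: "x * scale c y = scale c (x * y)"

locale infinitesimal_probability_space = complex_algebra scale
  for scale :: "complex \<Rightarrow> 'a::ring_1 \<Rightarrow> 'a" +
  fixes \<phi> \<phi>' :: "'a \<Rightarrow> complex"
  assumes linear_\<phi>: "Vector_Spaces.linear scale (*) \<phi>"
    and linear_\<phi>': "Vector_Spaces.linear scale (*) \<phi>'"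
    and \<phi>_one: "\<phi> 1 = 1"
    and \<phi>'_one: "\<phi>' 1 = 0"

definition subalgebra :: "(complex \<Rightarrow> 'a::ring_1 \<Rightarrow> 'a) \<Rightarrow> 'a set \<Rightarrow> bool" where
  "subalgebra scale S \<longleftrightarrow> module.subspace scale S \<and> (\<forall>x\<in>S. \<forall>y\<in>S. x * y \<in> S)"

definition unital_subalgebra :: "(complex \<Rightarrow> 'a::ring_1 \<Rightarrow> 'a) \<Rightarrow> 'a set \<Rightarrow> bool" where
  "unital_subalgebra scale S \<longleftrightarrow> subalgebra scale S \<and> 1 \<in> S"

definition infinitesimal_idempotent :: "('a::ring_1 \<Rightarrow> complex) \<Rightarrow> 'a \<Rightarrow> bool" where
  "infinitesimal_idempotent \<phi> j \<longleftrightarrow> j\<^sup>2 = j \<and> (\<forall>n\<ge>1. \<phi> (j ^ n) = 0)"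

text \<open>The element list \<open>xs\<close> is of the form \<open>x\<^sub>1, \<dots>, x\<^sub>n\<close> with \<open>n \<ge> 1\<close>, \<open>x\<^sub>k \<in> C i\<^sub>k\<close>,
  and \<open>i\<^sub>1 \<noteq> i\<^sub>2 \<noteq> \<dots> \<noteq> i\<^sub>n\<close>.\<close>

definition alternating :: "'i set \<Rightarrow> ('i \<Rightarrow> 'a set) \<Rightarrow> 'a list \<Rightarrow> bool" where
  "alternating I C xs \<longleftrightarrow> xs \<noteq> [] \<and>
     (\<exists>is. set is \<subseteq> I \<and> distinct_adj is \<and> list_all2 (\<lambda>i x. x \<in> C i) is xs)"

definition free ::
  "(complex \<Rightarrow> 'a::ring_1 \<Rightarrow> 'a) \<Rightarrow> ('a \<Rightarrow> complex) \<Rightarrow> 'i set \<Rightarrow> ('i \<Rightarrow> 'a set) \<Rightarrow> bool" where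
  "free scale \<phi> I C \<longleftrightarrow> (\<forall>i\<in>I. unital_subalgebra scale (C i)) \<and>
     (\<forall>xs. alternating I C xs \<and> (\<forall>x\<in>set xs. \<phi> x = 0) \<longrightarrow> \<phi> (prod_list xs) = 0)"

definition infinitesimally_free ::
  "(complex \<Rightarrow> 'a::ring_1 \<Rightarrow> 'a) \<Rightarrow> ('a \<Rightarrow> complex) \<Rightarrow> ('a \<Rightarrow> complex) \<Rightarrow>
    'i set \<Rightarrow> ('i \<Rightarrow> 'a set) \<Rightarrow> bool" where
  "infinitesimally_free scale \<phi> \<phi>' I C \<longleftrightarrow> (\<forall>i\<in>I. unital_subalgebra scale (C i)) \<and>
     (\<forall>xs. alternating I C xs \<and> (\<forall>x\<in>set xs. \<phi> x = 0) \<longrightarrow>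
        \<phi> (prod_list xs) = 0 \<and>
        \<phi>' (prod_list xs) =
          (\<Sum>k<length xs. \<phi>' (xs ! k) * \<phi> (prod_list (take k xs @ drop (Suc k) xs))))"

definition infinitesimally_free_from ::
  "(complex \<Rightarrow> 'a::ring_1 \<Rightarrow> 'a) \<Rightarrow> ('a \<Rightarrow> complex) \<Rightarrow> ('a \<Rightarrow> complex) \<Rightarrow>
    'i set \<Rightarrow> ('i \<Rightarrow> 'a set) \<Rightarrow> 'a \<Rightarrow> bool" where
  "infinitesimally_free_from scale \<phi> \<phi>' I A j \<longleftrightarrow>
     infinitesimally_free scale \<phi> \<phi>' (UNIV :: bool set)
       (\<lambda>b. if b then unital_subalgebra scale hull (\<Union>i\<in>I. A i)
            else unital_subalgebra scale hull {j})"

definition boolean_independent ::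
  "(complex \<Rightarrow> 'a::ring_1 \<Rightarrow> 'a) \<Rightarrow> ('a \<Rightarrow> complex) \<Rightarrow> 'i set \<Rightarrow> ('i \<Rightarrow> 'a set) \<Rightarrow> bool" where
  "boolean_independent scale \<psi> I D \<longleftrightarrow> (\<forall>i\<in>I. subalgebra scale (D i)) \<and>
     (\<forall>xs. alternating I D xs \<longrightarrow> \<psi> (prod_list xs) = prod_list (map \<psi> xs))"

definition j_letter :: "'a::ring_1 \<Rightarrow> int \<Rightarrow> 'a" where
  "j_letter j e = (if e = - 1 then j else 1 - j)"

text \<open>\<open>j_word j [\<epsilon>\<^sub>1, \<dots>, \<epsilon>\<^sub>k] [a\<^sub>1, \<dots>, a\<^sub>k]\<close> is \<open>j\<^bsup>(\<epsilon>\<^sub>1)\<^esup> a\<^sub>1 j\<^bsup>(\<epsilon>\<^sub>2)\<^esup> \<cdots> a\<^bsub>k-1\<^esub> j\<^bsup>(\<epsilon>\<^sub>k)\<^esup>\<close>;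
  the last entry \<open>a\<^sub>k\<close> does not occur in the word.  The empty word is \<open>1\<close>.\<close>

fun j_word :: "'a::ring_1 \<Rightarrow> int list \<Rightarrow> 'a list \<Rightarrow> 'a" where
  "j_word j [] as = 1"
| "j_word j [e] as = j_letter j e"
| "j_word j (e # e' # es) as = j_letter j e * hd as * j_word j (e' # es) (tl as)"

definition J_alg :: "(complex \<Rightarrow> 'a::ring_1 \<Rightarrow> 'a) \<Rightarrow> 'a \<Rightarrow> 'a set \<Rightarrow> 'a set" where
  "J_alg scale j B = subalgebra scale hull
     {j_word j es as | es as. set es \<subseteq> {- 1, 1} \<and> set as \<subseteq> B \<and> length as = length es}"

text \<open>The generators of \<open>\<J>\<^sub>a(B)\<close> are the words with alternating signs, except for the two degenerate
  words whose sign condition is vacuous and which do not begin or end with \<open>j\<close>: the empty word \<open>1\<close>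
  and the one-letter word \<open>1 - j\<close>.  (The one-letter word \<open>j\<close> is kept.)  Either of them would be an
  element \<open>u\<close> of \<open>\<J>\<^sub>a(B)\<close> for every \<open>B\<close>, and Boolean independence of \<open>\<J>\<^sub>a(B\<^sub>1)\<close>, \<open>\<J>\<^sub>a(B\<^sub>2)\<close> would
  fail: for \<open>a \<in> B\<^sub>1\<close>, \<open>x = j a (1 - j)\<close> and \<open>y = (1 - j) a j\<close> one has \<open>\<psi>(x) = 0\<close>, but
  \<open>\<psi>(x u y) = \<psi>(j a (1 - j) a j) = \<phi>(a\<^sup>2) - \<phi>(a)\<^sup>2\<close>.\<close>

definition Ja_alg :: "(complex \<Rightarrow> 'a::ring_1 \<Rightarrow> 'a) \<Rightarrow> 'a \<Rightarrow> 'a set \<Rightarrow> 'a set" where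
  "Ja_alg scale j B = subalgebra scale hull
     {j_word j es as | es as. set es \<subseteq> {- 1, 1} \<and> set as \<subseteq> B \<and> length as = length es \<and>
        distinct_adj es \<and> es \<noteq> [] \<and> es \<noteq> [1]}"

end

theory Submission
  imports Defs
begin

text \<open>
  Let \<open>C\<close> be the unital algebra generated by all \<open>A\<^sub>i\<close>.  The whole theorem rests on one formula,
  valid for \<open>c\<^sub>0, \<dots>, c\<^sub>n \<in> C\<close>:
  \<open>\<psi>(c\<^sub>0 j c\<^sub>1 j \<cdots> j c\<^sub>n) = \<phi>(c\<^sub>0) \<phi>(c\<^sub>1) \<cdots> \<phi>(c\<^sub>n)\<close>.
  It holds because \<open>\<phi>\<close> vanishes on every word containing \<open>j\<close>: once the letters from \<open>C\<close> are
  centered, such a word is alternating and centered, and the scalars split off during centering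
  only merge neighbouring copies of the idempotent \<open>j\<close>, so that at least one of them survives.
  Consequently, in the Leibniz-type formula for \<open>\<phi>'\<close> on a centered word ending in \<open>j\<close>, each term
  deletes one letter and evaluates \<open>\<phi>\<close> on the rest; this is \<open>0\<close> if another \<open>j\<close> remains, and also
  for \<open>c j\<close>, where the rest is \<open>c\<close> or \<open>j\<close>.  Hence only the word \<open>j\<close> itself contributes, with value
  \<open>\<phi>'(j)\<close> (lemma \<open>phi'_sandwich\<close>).

  The formula says that \<open>j\<close> cuts \<open>\<psi>\<close> into factors: \<open>\<psi>(x j y) = \<psi>(x) \<psi>(y)\<close> for all \<open>x, y\<close> in the
  algebra generated by \<open>C\<close> and \<open>j\<close> (lemma \<open>psi_mult_j_mult\<close>).  Elements of the compressions
  \<open>j \<J>(A\<^sub>i) j\<close> absorb a \<open>j\<close> at either side, so \<open>\<psi>\<close> is multiplicative on products of them, whatever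
  the indices.

  For \<open>\<J>\<^sub>a\<close>, write \<open>x y = x j y + x (1 - j) y\<close>.  The first summand contributes \<open>\<psi>(x) \<psi>(y)\<close>, and it
  remains to see that the second contributes nothing when \<open>x \<in> \<J>\<^sub>a(A\<^sub>i)\<close> and \<open>y\<close> starts with a factor
  in \<open>\<J>\<^sub>a(A\<^sub>k)\<close>, \<open>i \<noteq> k\<close>.  As the signs alternate, a generator that does not end in \<open>j\<close> ends in
  \<open>j a (1 - j)\<close>, and one that does not start with \<open>j\<close> starts with \<open>(1 - j) b j\<close>.  So what has to
  vanish is \<open>\<psi>(a (1 - j) b) = \<phi>(a b) - \<phi>(a) \<phi>(b)\<close>, and freeness of \<open>A\<^sub>i\<close> and \<open>A\<^sub>k\<close> makes it vanish.
\<close>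

section \<open>Subalgebras\<close>

lemma (in complex_algebra) subalgebra_hull: "subalgebra scale (subalgebra scale hull S)"
  by (rule hull_in) (auto simp: subalgebra_def intro!: subspace_Inter)

lemma (in complex_algebra) span_mult_closed:
  assumes S: "\<And>s t. s \<in> S \<Longrightarrow> t \<in> S \<Longrightarrow> s * t \<in> S"
    and x: "x \<in> span S" and y: "y \<in> span S"
  shows "x * y \<in> span S"
  using x
proof (induction rule: span_induct)
  case base
  show ?case
    by (auto simp: subspace_def distrib_right scale_mult_left span_zero span_add span_scale)
next
  case (step s)
  show ?case
    using y
  proof (induction rule: span_induct)
    case base
    show ?case
      by (auto simp: subspace_def distrib_left scale_mult_right span_zero span_add span_scale)
  qed (use S step span_base in blast)
qed

lemma in_set_remove_nth:
  assumes "i < length xs" "i \<noteq> k"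
  shows "xs ! i \<in> set (take k xs @ drop (Suc k) xs)"
proof (cases "i < k")
  case True
  then have "take k xs ! i = xs ! i" "i < length (take k xs)" using assms by auto
  then show ?thesis by (metis Un_iff nth_mem set_append)
next
  case False
  then have "drop (Suc k) xs ! (i - Suc k) = xs ! i" "i - Suc k < length (drop (Suc k) xs)"
    using assms by auto
  then show ?thesis by (metis Un_iff nth_mem set_append)
qed

lemma list_all2_mem_subset:
  assumes "list_all2 (\<lambda>i x. x \<in> D i) is xs" "\<And>i. i \<in> set is \<Longrightarrow> D i \<subseteq> S"
  shows "set xs \<subseteq> S"
  using assms by (induction rule: list_all2_induct) auto

section \<open>Centering\<close>

context infinitesimal_probability_space
begin

lemma phi_add: "\<phi> (x + y) = \<phi> x + \<phi> y" and phi_scale: "\<phi> (scale c x) = c * \<phi> x"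
  and phi'_add: "\<phi>' (x + y) = \<phi>' x + \<phi>' y" and phi'_scale: "\<phi>' (scale c x) = c * \<phi>' x"
  using linear_\<phi> linear_\<phi>' by (auto simp: Vector_Spaces.linear_iff)

lemma linear_phi_factors: "Vector_Spaces.linear scale (*) (\<lambda>x. \<phi> (p * x * q))"
  and linear_phi'_factors: "Vector_Spaces.linear scale (*) (\<lambda>x. \<phi>' (p * x * q))"
  using linear_\<phi> linear_\<phi>'
  by (auto simp: Vector_Spaces.linear_iff distrib_left distrib_right scale_mult_left scale_mult_right)

text \<open>Split \<open>c\<close> into \<open>\<phi>(c)\<close> and its centered part.  This is applied to one letter of a word at a
  time, \<open>g\<close> being \<open>\<phi>\<close> or \<open>\<phi>'\<close> of the word as a function of that letter.\<close>

lemma centering: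
  assumes g: "Vector_Spaces.linear scale (*) g"
    and C: "unital_subalgebra scale C"
    and vanish: "\<And>d. d \<in> C \<Longrightarrow> \<phi> d = 0 \<Longrightarrow> g d = 0"
    and c: "c \<in> C"
  shows "g c = \<phi> c * g 1"
proof -
  define d where "d = c - scale (\<phi> c) 1"
  have cd: "c = scale (\<phi> c) 1 + d" by (simp add: d_def)
  have "d \<in> C"
    using C c unfolding d_def unital_subalgebra_def subalgebra_def
    by (metis subspace_diff subspace_scale)
  moreover have "\<phi> c = \<phi> c + \<phi> d"
    using phi_add phi_scale \<phi>_one cd by (metis mult.right_neutral)
  ultimately have "g d = 0" using vanish by simp
  moreover have "g c = \<phi> c * g 1 + g d"
    using g cd by (metis Vector_Spaces.linear_iff)
  ultimately show ?thesis by simp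
qed

lemma free_mult:
  assumes "free scale \<phi> I A" "i \<in> I" "k \<in> I" "i \<noteq> k" "a \<in> A i" "b \<in> A k"
  shows "\<phi> (a * b) = \<phi> a * \<phi> b"
proof -
  have Ai: "unital_subalgebra scale (A i)" and Ak: "unital_subalgebra scale (A k)"
    using assms by (auto simp: free_def)
  have 0: "\<phi> (d * e) = 0" if "d \<in> A i" "\<phi> d = 0" "e \<in> A k" "\<phi> e = 0" for d e
  proof -
    have "alternating I A [d, e]"
      unfolding alternating_def using that assms by (auto intro!: exI[of _ "[i, k]"])
    then show ?thesis
      using assms(1) that unfolding free_def by force
  qed
  have 1: "\<phi> (d * b) = 0" if "d \<in> A i" "\<phi> d = 0" for d
    using centering[OF linear_phi_factors[of d 1] Ak _ \<open>b \<in> A k\<close>] 0 that by simp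
  show ?thesis
    using centering[OF linear_phi_factors[of 1 b] Ai _ \<open>a \<in> A i\<close>] 1 by simp
qed

end

section \<open>Moments of words in an infinitesimal idempotent\<close>

locale free_infinitesimal_idempotent = infinitesimal_probability_space scale \<phi> \<phi>'
  for scale :: "complex \<Rightarrow> 'a::ring_1 \<Rightarrow> 'a" and \<phi> \<phi>' :: "'a \<Rightarrow> complex" +
  fixes C D :: "'a set" and j :: 'a
  assumes j: "infinitesimal_idempotent \<phi> j" and j_in: "j \<in> D"
    and phi'_j: "\<phi>' j \<noteq> 0"
    and inf_free: "infinitesimally_free scale \<phi> \<phi>' (UNIV :: bool set) (\<lambda>b. if b then C else D)"
begin

lemma jj: "j * j = j"
  using j by (simp add: infinitesimal_idempotent_def power2_eq_square)

lemma j_mult_j: "j * (j * x) = j * x"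
  by (simp add: jj flip: mult.assoc)

lemma phi_j: "\<phi> j = 0"
proof -
  have "\<phi> (j ^ 1) = 0" using j unfolding infinitesimal_idempotent_def by blast
  then show ?thesis by simp
qed

lemma C_unital: "unital_subalgebra scale C"
  using inf_free[unfolded infinitesimally_free_def, THEN conjunct1, THEN bspec[of _ _ True]]
  by simp

lemma one_in_C: "1 \<in> C" and C_mult: "a \<in> C \<Longrightarrow> b \<in> C \<Longrightarrow> a * b \<in> C"
  using C_unital by (auto simp: unital_subalgebra_def subalgebra_def)

text \<open>The word \<open>j c\<^sub>1 j c\<^sub>2 j \<cdots> c\<^sub>n j\<close>, bounded by \<open>j\<close> on both sides.\<close>

definition sandwich :: "'a list \<Rightarrow> 'a" where
  "sandwich cs = j * prod_list (map (\<lambda>c. c * j) cs)"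

lemma sandwich_Nil: "sandwich [] = j"
  by (simp add: sandwich_def)

lemma sandwich_append_Cons: "sandwich (cs @ c # ds) = sandwich cs * c * sandwich ds"
  by (simp add: sandwich_def mult.assoc)

lemma sandwich_mult_j: "sandwich cs * j = sandwich cs"
  by (induction cs rule: rev_induct) (simp_all add: sandwich_def jj mult.assoc)

text \<open>Replacing a letter by \<open>1\<close> deletes it, since the two copies of \<open>j\<close> next to it merge.\<close>

lemma sandwich_append: "sandwich (cs @ ds) = sandwich cs * sandwich ds"
proof -
  have "sandwich cs * sandwich ds = (sandwich cs * j) * prod_list (map (\<lambda>c. c * j) ds)"
    by (simp add: sandwich_def[of ds] mult.assoc)
  also have "\<dots> = sandwich (cs @ ds)"
    by (simp add: sandwich_mult_j) (simp add: sandwich_def mult.assoc)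
  finally show ?thesis by simp
qed

text \<open>The factors of \<^term>\<open>sandwich cs\<close> as a list: infinitesimal freeness speaks of lists of
  factors, not of their products.\<close>

definition letters :: "'a list \<Rightarrow> 'a list" where
  "letters cs = j # concat (map (\<lambda>c. [c, j]) cs)"

lemma letters_Cons: "letters (c # cs) = j # c # letters cs"
  by (simp add: letters_def)

lemma prod_list_letters: "prod_list (letters cs) = sandwich cs"
  by (induction cs) (auto simp: letters_def sandwich_def mult.assoc)

lemma set_letters: "set (letters cs) = insert j (set cs)"
  by (auto simp: letters_def)

lemma last_letters: "last (letters cs) = j"
  by (induction cs rule: rev_induct) (auto simp: letters_def)

lemma letters_indices:
  assumes "set cs \<subseteq> C"
  shows "\<exists>bs. bs \<noteq> [] \<and> distinct_adj bs \<and> \<not> hd bs \<and> \<not> last bs \<and>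
    list_all2 (\<lambda>b x. x \<in> (if b then C else D)) bs (letters cs)"
  using assms
proof (induction cs)
  case Nil
  show ?case by (rule exI[of _ "[False]"]) (simp add: letters_def j_in)
next
  case (Cons c cs)
  then obtain bs where "bs \<noteq> []" "distinct_adj bs" "\<not> hd bs" "\<not> last bs"
    "list_all2 (\<lambda>b x. x \<in> (if b then C else D)) bs (letters cs)" by auto
  then show ?case
    using Cons.prems j_in
    by (intro exI[of _ "False # True # bs"]) (auto simp: letters_Cons distinct_adj_Cons)
qed

lemma alternating_letters:
  assumes "set cs \<subseteq> C" "la = [] \<or> (\<exists>a\<in>C. la = [a])" "lb = [] \<or> (\<exists>b\<in>C. lb = [b])"
  shows "alternating (UNIV :: bool set) (\<lambda>b. if b then C else D) (la @ letters cs @ lb)"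
proof -
  obtain bs where bs: "bs \<noteq> []" "distinct_adj bs" "\<not> hd bs" "\<not> last bs"
    "list_all2 (\<lambda>b x. x \<in> (if b then C else D)) bs (letters cs)"
    using letters_indices[OF assms(1)] by blast
  have "distinct_adj (map (\<lambda>_. True) la @ bs @ map (\<lambda>_. True) lb)"
    using bs assms(2,3) by (auto simp: distinct_adj_Cons distinct_adj_append_iff)
  moreover have "list_all2 (\<lambda>b x. x \<in> (if b then C else D))
      (map (\<lambda>_. True) la @ bs @ map (\<lambda>_. True) lb) (la @ letters cs @ lb)"
    using bs assms(2,3) by (intro list_all2_appendI) (auto simp del: if_bool_eq_conj)
  moreover have "la @ letters cs @ lb \<noteq> []" by (simp add: letters_def)
  ultimately show ?thesis unfolding alternating_def by blast
qed

lemma phi_sandwich_centered: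
  assumes ds: "set ds \<subseteq> C" "\<And>d. d \<in> set ds \<Longrightarrow> \<phi> d = 0" and a: "a \<in> C" and b: "b \<in> C"
  shows "\<phi> (a * sandwich ds * b) = 0"
proof -
  have outer: "\<phi> (prod_list (la @ letters ds @ lb)) = 0"
    if "la = [] \<or> (\<exists>d\<in>C. \<phi> d = 0 \<and> la = [d])" "lb = [] \<or> (\<exists>d\<in>C. \<phi> d = 0 \<and> lb = [d])" for la lb
  proof -
    have "alternating (UNIV :: bool set) (\<lambda>b. if b then C else D) (la @ letters ds @ lb)"
      using alternating_letters ds(1) that by blast
    moreover have "\<forall>x\<in>set (la @ letters ds @ lb). \<phi> x = 0"
      using that ds(2) phi_j by (auto simp: set_letters)
    ultimately show ?thesis using inf_free unfolding infinitesimally_free_def by blast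
  qed
  have left: "\<phi> (a * sandwich ds * prod_list lb) = 0"
    if "lb = [] \<or> (\<exists>d\<in>C. \<phi> d = 0 \<and> lb = [d])" for lb
  proof -
    have "\<phi> (d * (sandwich ds * prod_list lb)) = 0" if "d \<in> C" "\<phi> d = 0" for d
      using outer[of "[d]" lb] that \<open>lb = [] \<or> _\<close> by (simp add: prod_list_letters)
    moreover have "\<phi> (sandwich ds * prod_list lb) = 0"
      using outer[of "[]" lb] that by (simp add: prod_list_letters)
    ultimately show ?thesis
      using centering[OF linear_phi_factors[of 1 "sandwich ds * prod_list lb"] C_unital _ a]
      by (simp add: mult.assoc)
  qed
  show ?thesis
    using centering[OF linear_phi_factors[of "a * sandwich ds" 1] C_unital _ b]
      left[of "[]"] left[of "[d]" for d] by simp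
qed

text \<open>The letters are centered from left to right: \<open>ds\<close> in the induction collects those already
  centered.  The scalar part of a letter leads to a shorter word that still contains \<open>j\<close>.\<close>

lemma phi_sandwich:
  assumes "set cs \<subseteq> C" and "a \<in> C" and "b \<in> C"
  shows "\<phi> (a * sandwich cs * b) = 0"
proof -
  have "\<phi> (a * sandwich (ds @ cs) * b) = 0"
    if "set ds \<subseteq> C" "\<And>d. d \<in> set ds \<Longrightarrow> \<phi> d = 0" for ds
    using that assms(1)
  proof (induction cs arbitrary: ds)
    case Nil
    then show ?case using phi_sandwich_centered assms by simp
  next
    case (Cons c cs)
    let ?p = "a * sandwich ds" and ?q = "sandwich cs * b"
    have "\<phi> (?p * d * ?q) = 0" if "d \<in> C" "\<phi> d = 0" for d
      using Cons.IH[of "ds @ [d]"] that Cons.prems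
      by (auto simp: sandwich_append_Cons mult.assoc)
    moreover have "\<phi> (?p * 1 * ?q) = 0"
      using Cons.IH[of ds] Cons.prems by (simp add: sandwich_append mult.assoc)
    ultimately have "\<phi> (?p * c * ?q) = 0"
      using centering[OF linear_phi_factors[of ?p ?q] C_unital, of c] Cons.prems by simp
    then show ?case by (simp add: sandwich_append_Cons mult.assoc)
  qed
  from this[of "[]"] show ?thesis by simp
qed

text \<open>Since \<open>\<psi>(x)\<close> only depends on \<open>x j\<close>, this normal form describes \<open>\<psi>\<close> on all words, whether
  they end in \<open>j\<close> or not.  A letter \<open>j\<close> in front is absorbed with \<open>1 \<in> C\<close> as the new first
  letter.\<close>

lemma word_mult_j:
  assumes "set xs \<subseteq> insert j C"
  shows "\<exists>a\<in>C. \<exists>cs. set cs \<subseteq> C \<and> prod_list xs * j = a * sandwich cs"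
  using assms
proof (induction xs)
  case Nil
  show ?case using one_in_C by (auto intro!: bexI[of _ 1] exI[of _ "[]"] simp: sandwich_Nil)
next
  case (Cons x xs)
  then obtain a cs where ih: "a \<in> C" "set cs \<subseteq> C" "prod_list xs * j = a * sandwich cs" by auto
  show ?case
  proof (cases "x = j")
    case True
    then have "prod_list (x # xs) * j = 1 * sandwich (a # cs)"
      using ih(3) sandwich_append_Cons[of "[]" a cs] by (simp add: sandwich_Nil mult.assoc)
    then show ?thesis using ih one_in_C by (metis insert_subset list.simps(15))
  next
    case False
    then have "prod_list (x # xs) * j = (x * a) * sandwich cs" "x * a \<in> C"
      using ih Cons.prems by (simp_all add: mult.assoc C_mult)
    then show ?thesis using ih by blast
  qed
qed

lemma phi_word_containing_j:
  assumes "set xs \<subseteq> insert j C" "j \<in> set xs"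
  shows "\<phi> (prod_list xs) = 0"
proof -
  obtain ys zs where xs: "xs = ys @ j # zs" "j \<notin> set zs"
    using split_list_last[OF assms(2)] by blast
  have "set zs \<subseteq> C" using assms(1) xs by auto
  then have zs: "prod_list zs \<in> C" by (induction zs) (auto simp: one_in_C C_mult)
  have "set ys \<subseteq> insert j C" using assms(1) xs by simp
  then obtain a cs where "a \<in> C" "set cs \<subseteq> C" "prod_list ys * j = a * sandwich cs"
    using word_mult_j by blast
  then have "\<phi> (prod_list ys * j * prod_list zs) = 0" using phi_sandwich zs by simp
  then show ?thesis by (simp add: xs mult.assoc)
qed

text \<open>Every term of the Leibniz-type sum vanishes.  If there is a letter inside the sandwich, then
  \<open>j\<close> occurs at least twice, so one \<open>j\<close> survives the deletion and \<open>\<phi>\<close> of the rest is \<open>0\<close>.  The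
  only other case is a word \<open>d j\<close> with \<open>\<phi>(d) = \<phi>(j) = 0\<close>.\<close>

lemma phi'_letters_centered:
  assumes ds: "set ds \<subseteq> C" "\<And>d. d \<in> set ds \<Longrightarrow> \<phi> d = 0"
    and la: "la = [] \<or> (\<exists>d\<in>C. \<phi> d = 0 \<and> la = [d])"
    and nontrivial: "la @ ds \<noteq> []"
  shows "\<phi>' (prod_list (la @ letters ds)) = 0"
proof -
  let ?xs = "la @ letters ds"
  have "alternating (UNIV :: bool set) (\<lambda>b. if b then C else D) ?xs"
    using alternating_letters[OF ds(1), of la "[]"] la by auto
  moreover have "\<forall>x\<in>set ?xs. \<phi> x = 0"
    using la ds(2) phi_j by (auto simp: set_letters)
  ultimately have *: "\<phi>' (prod_list ?xs) =
      (\<Sum>k<length ?xs. \<phi>' (?xs ! k) * \<phi> (prod_list (take k ?xs @ drop (Suc k) ?xs)))"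
    using inf_free unfolding infinitesimally_free_def by blast
  show ?thesis
  proof (cases ds)
    case Nil
    then obtain d where "la = [d]" "\<phi> d = 0" using la nontrivial by auto
    then show ?thesis using * Nil phi_j by (simp add: letters_def lessThan_Suc)
  next
    case (Cons d ds')
    have "\<phi> (prod_list (take k ?xs @ drop (Suc k) ?xs)) = 0" for k
    proof (rule phi_word_containing_j)
      have "set ?xs \<subseteq> insert j C" using la ds(1) by (auto simp: set_letters)
      then show "set (take k ?xs @ drop (Suc k) ?xs) \<subseteq> insert j C"
        using set_take_subset[of k ?xs] set_drop_subset[of "Suc k" ?xs] by auto
      \<comment> \<open>The first and the last \<open>j\<close> sit at different positions, so at most one of them is deleted.\<close>
      let ?n = "length ?xs - 1"
      have first: "?xs ! length la = j" "length la < length ?xs"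
        by (simp_all add: nth_append letters_def)
      have ne: "?xs \<noteq> []" by (simp add: letters_def)
      then have last: "?xs ! ?n = j" "?n < length ?xs"
        using last_conv_nth[OF ne] last_letters[of ds] by (auto simp: letters_def)
      have "length la \<noteq> ?n" by (simp add: Cons letters_def)
      then show "j \<in> set (take k ?xs @ drop (Suc k) ?xs)"
        using in_set_remove_nth[OF first(2), of k] in_set_remove_nth[OF last(2), of k] first last
        by metis
    qed
    then show ?thesis using * by simp
  qed
qed

text \<open>Letters are centered from left to right as for \<open>\<phi>\<close>.  Both sides are linear in each letter and
  vanish when a letter is centered, so only the product of all the scalar parts remains, multiplied
  by the value \<open>\<phi>'(j)\<close> at the empty sandwich.\<close>

lemma phi'_sandwich:
  assumes "set cs \<subseteq> C" and a: "a \<in> C"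
  shows "\<phi>' (a * sandwich cs) = \<phi>' j * \<phi> a * prod_list (map \<phi> cs)"
proof -
  have "\<phi>' (a * sandwich (ds @ cs)) = \<phi>' j * \<phi> a * prod_list (map \<phi> (ds @ cs))"
    if "set ds \<subseteq> C" "\<And>d. d \<in> set ds \<Longrightarrow> \<phi> d = 0" for ds
    using that assms(1)
  proof (induction cs arbitrary: ds)
    case Nil
    have "\<phi>' (d * sandwich ds) = 0" if "d \<in> C" "\<phi> d = 0" for d
      using phi'_letters_centered[of ds "[d]"] that Nil by (simp add: prod_list_letters)
    then have "\<phi>' (a * sandwich ds) = \<phi> a * \<phi>' (sandwich ds)"
      using centering[OF linear_phi'_factors[of 1 "sandwich ds"] C_unital _ a] by simp
    also have "\<phi>' (sandwich ds) = \<phi>' j * prod_list (map \<phi> ds)"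
    proof (cases "ds = []")
      case False
      then have "\<phi>' (sandwich ds) = 0"
        using phi'_letters_centered[of ds "[]"] Nil by (simp add: prod_list_letters)
      moreover have "prod_list (map \<phi> ds) = 0"
        using False Nil by (cases ds) auto
      ultimately show ?thesis by simp
    qed (simp add: sandwich_Nil)
    finally show ?case by simp
  next
    case (Cons c cs)
    let ?p = "a * sandwich ds" and ?q = "sandwich cs"
    have "\<phi>' (?p * d * ?q) = 0" if "d \<in> C" "\<phi> d = 0" for d
    proof -
      have "\<phi>' (a * sandwich ((ds @ [d]) @ cs)) =
          \<phi>' j * \<phi> a * prod_list (map \<phi> ((ds @ [d]) @ cs))"
        using Cons.IH[of "ds @ [d]"] that Cons.prems by auto
      then show ?thesis using that by (simp add: sandwich_append_Cons mult.assoc)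
    qed
    then have "\<phi>' (?p * c * ?q) = \<phi> c * \<phi>' (?p * 1 * ?q)"
      using centering[OF linear_phi'_factors[of ?p ?q] C_unital, of c] Cons.prems by simp
    also have "\<phi>' (?p * 1 * ?q) = \<phi>' j * \<phi> a * prod_list (map \<phi> (ds @ cs))"
      using Cons.IH[of ds] Cons.prems by (simp add: sandwich_append mult.assoc)
    finally show ?case by (simp add: sandwich_append_Cons mult.assoc)
  qed
  from this[of "[]"] show ?thesis by simp
qed

section \<open>Multiplicativity at the idempotent\<close>

definition \<psi> :: "'a \<Rightarrow> complex" where
  "\<psi> x = \<phi>' (x * j) / \<phi>' j"

definition words :: "'a set" where
  "words = {prod_list xs | xs. set xs \<subseteq> insert j C}"

text \<open>This is the algebra generated by \<open>C\<close> and \<open>j\<close>.  As a span of words it allows bilinear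
  identities to be checked on words alone, which a hull of subalgebras would not.\<close>

definition word_alg :: "'a set" where
  "word_alg = span words"

lemma psi_add: "\<psi> (x + y) = \<psi> x + \<psi> y"
  and psi_scale: "\<psi> (scale c x) = c * \<psi> x"
  by (simp_all add: \<psi>_def distrib_right scale_mult_left phi'_add phi'_scale add_divide_distrib)

lemma psi_zero: "\<psi> 0 = 0"
  using psi_scale[of 0 0] by simp

lemma psi_diff: "\<psi> (x - y) = \<psi> x - \<psi> y"
  using psi_add[of "x - y" y] by simp

lemma psi_C: "a \<in> C \<Longrightarrow> \<psi> a = \<phi> a"
  using phi'_sandwich[of "[]" a] phi'_j by (simp add: \<psi>_def sandwich_Nil)

lemma words_mult: "x \<in> words \<Longrightarrow> y \<in> words \<Longrightarrow> x * y \<in> words"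
  unfolding words_def by (clarsimp, metis Un_least prod_list.append set_append)

lemma word_alg_mult: "x \<in> word_alg \<Longrightarrow> y \<in> word_alg \<Longrightarrow> x * y \<in> word_alg"
  unfolding word_alg_def using words_mult by (rule span_mult_closed)

lemma word_alg_subspace: "subspace word_alg"
  by (simp add: word_alg_def)

lemma word_alg_subalgebra: "subalgebra scale word_alg"
  using word_alg_subspace word_alg_mult by (simp add: subalgebra_def)

lemma one_in_word_alg: "1 \<in> word_alg"
  unfolding word_alg_def words_def by (intro span_base) (auto intro!: exI[of _ "[]"])

lemma C_in_word_alg: "a \<in> C \<Longrightarrow> a \<in> word_alg"
  unfolding word_alg_def words_def by (intro span_base) (auto intro!: exI[of _ "[a]"])

lemma j_in_word_alg: "j \<in> word_alg"
  unfolding word_alg_def words_def by (intro span_base) (auto intro!: exI[of _ "[j]"])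

lemma jperp_in_word_alg: "1 - j \<in> word_alg"
  using subspace_diff[OF word_alg_subspace one_in_word_alg j_in_word_alg] .

text \<open>Concatenating two normal forms at \<open>j\<close> gives a normal form again, whose letters are those of both
  words; and \<open>\<psi>\<close> of a normal form is the product of \<open>\<phi>\<close> over its letters.\<close>

lemma psi_word_j_word:
  assumes "x \<in> words" "y \<in> words"
  shows "\<psi> (x * j * y) = \<psi> x * \<psi> y"
proof -
  obtain a cs where x: "a \<in> C" "set cs \<subseteq> C" "x * j = a * sandwich cs"
    using assms word_mult_j unfolding words_def by blast
  obtain b ds where y: "b \<in> C" "set ds \<subseteq> C" "y * j = b * sandwich ds"
    using assms word_mult_j unfolding words_def by blast
  have "x * j * y * j = (x * j) * (y * j)" by (simp add: mult.assoc)
  also have "\<dots> = a * sandwich (cs @ b # ds)"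
    unfolding x y by (simp add: sandwich_append_Cons mult.assoc)
  finally have xy: "x * j * y * j = a * sandwich (cs @ b # ds)" .
  show ?thesis
    unfolding \<psi>_def xy unfolding x(3) y(3)
    using x y phi'_j by (subst (1 2 3) phi'_sandwich) auto
qed

lemma psi_mult_j_mult:
  assumes x: "x \<in> word_alg" and y: "y \<in> word_alg"
  shows "\<psi> (x * j * y) = \<psi> x * \<psi> y"
  using x unfolding word_alg_def
proof (induction rule: span_induct)
  case base
  show ?case
    by (auto simp: subspace_def distrib_right scale_mult_left psi_add psi_scale psi_zero)
next
  case (step x)
  show ?case
    using y unfolding word_alg_def
  proof (induction rule: span_induct)
    case base
    show ?case
      by (auto simp: subspace_def distrib_left scale_mult_right psi_add psi_scale psi_zero)
  qed (use step psi_word_j_word in blast)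
qed

section \<open>The compressed algebras\<close>

lemma j_letter_in_word_alg: "j_letter j e \<in> word_alg"
  by (simp add: j_letter_def j_in_word_alg jperp_in_word_alg)

lemma j_word_in_word_alg:
  assumes "set as \<subseteq> C" "length as = length es"
  shows "j_word j es as \<in> word_alg"
  using assms
proof (induction es arbitrary: "as")
  case Nil
  show ?case by (simp add: one_in_word_alg)
next
  case (Cons e es)
  then obtain a as' where "as": "as = a # as'" "a \<in> C" "j_word j es as' \<in> word_alg"
    by (cases "as") auto
  then show ?case
    by (cases es) (simp_all add: word_alg_mult j_letter_in_word_alg C_in_word_alg)
qed

lemma J_alg_in_word_alg: "B \<subseteq> C \<Longrightarrow> J_alg scale j B \<subseteq> word_alg"
  unfolding J_alg_def by (rule hull_minimal) (auto intro!: j_word_in_word_alg word_alg_subalgebra)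

lemma Ja_alg_in_word_alg: "B \<subseteq> C \<Longrightarrow> Ja_alg scale j B \<subseteq> word_alg"
  unfolding Ja_alg_def by (rule hull_minimal) (auto intro!: j_word_in_word_alg word_alg_subalgebra)

text \<open>It makes the compression \<open>j \<J>(B) j\<close> closed under products: \<open>(j x j)(j y j) = j (x j y) j\<close>.\<close>

lemma j_in_J_alg:
  assumes "1 \<in> B"
  shows "j \<in> J_alg scale j B"
  unfolding J_alg_def
  by (rule hull_inc, rule CollectI, rule exI[of _ "[- 1]"], rule exI[of _ "[1]"])
    (simp add: assms j_letter_def)

lemma compression_subalgebra:
  assumes S: "subalgebra scale S" and "j \<in> S"
  shows "subalgebra scale ((\<lambda>x. j * x * j) ` S)"
proof -
  have "subspace ((\<lambda>x. j * x * j) ` S)"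
    unfolding subspace_def
  proof (intro conjI ballI allI)
    have S': "subspace S" using S by (simp add: subalgebra_def)
    show "0 \<in> (\<lambda>x. j * x * j) ` S"
      using subspace_0[OF S'] by (intro image_eqI[of _ _ 0]) auto
    fix x assume "x \<in> (\<lambda>x. j * x * j) ` S"
    then obtain x' where x': "x' \<in> S" "x = j * x' * j" by blast
    show "scale c x \<in> (\<lambda>x. j * x * j) ` S" for c
      using subspace_scale[OF S' x'(1), of c] x'(2)
      by (intro image_eqI[of _ _ "scale c x'"]) (auto simp: scale_mult_left scale_mult_right)
    fix y assume "y \<in> (\<lambda>x. j * x * j) ` S"
    then obtain y' where y': "y' \<in> S" "y = j * y' * j" by blast
    show "x + y \<in> (\<lambda>x. j * x * j) ` S"
      using subspace_add[OF S' x'(1) y'(1)] x'(2) y'(2)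
      by (intro image_eqI[of _ _ "x' + y'"]) (auto simp: distrib_left distrib_right)
  qed
  moreover have "j * x * j * (j * y * j) = j * (x * j * y) * j" for x y
    by (simp add: mult.assoc j_mult_j)
  ultimately show ?thesis
    using assms unfolding subalgebra_def by auto
qed

lemma compression_multiplicative:
  assumes "xs \<noteq> []" "set xs \<subseteq> (\<lambda>x. j * x * j) ` word_alg"
  shows "\<psi> (prod_list xs) = prod_list (map \<psi> xs)"
proof -
  have "\<psi> (prod_list xs) = prod_list (map \<psi> xs) \<and> prod_list xs \<in> word_alg"
    using assms(2)
  proof (induction xs)
    case Nil
    show ?case using psi_C[OF one_in_C] \<phi>_one one_in_word_alg by simp
  next
    case (Cons x xs)
    then obtain x' where x': "x' \<in> word_alg" "x = j * x' * j" by auto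
    have x: "x \<in> word_alg" using x' word_alg_mult j_in_word_alg by simp
    have "x * prod_list xs = x * j * prod_list xs"
      by (simp add: x' mult.assoc j_mult_j)
    then show ?case using psi_mult_j_mult[OF x] Cons word_alg_mult x j_in_word_alg by simp
  qed
  then show ?thesis by simp
qed

section \<open>Alternating words\<close>

lemma j_word_start:
  assumes "distinct_adj es" "set es \<subseteq> {- 1, 1}" "es \<noteq> []" "es \<noteq> [1]"
    and "set as \<subseteq> B" "length as = length es" "B \<subseteq> C"
  shows "\<exists>w\<in>word_alg. j_word j es as = j * w \<or> (\<exists>b\<in>B. j_word j es as = (1 - j) * b * j * w)"
proof -
  have start_j: "\<exists>w\<in>word_alg. j_word j (- 1 # es') as' = j * w"
    if as': "set as' \<subseteq> B" "length as' = Suc (length es')" for es' as'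
  proof (cases es')
    case Nil
    then show ?thesis using one_in_word_alg by (auto simp: j_letter_def intro!: bexI[of _ 1])
  next
    case (Cons e es'')
    obtain a as'' where "as' = a # as''" using as' by (cases as') auto
    moreover have "a * j_word j es' as'' \<in> word_alg"
      using calculation as' assms(7) by (intro word_alg_mult[OF C_in_word_alg j_word_in_word_alg]) auto
    ultimately show ?thesis
      using Cons by (auto simp: j_letter_def mult.assoc)
  qed
  obtain e es' where es: "es = e # es'" using assms(3) by (cases es) auto
  show ?thesis
  proof (cases "e = - 1")
    case True
    then show ?thesis using start_j[of "as" es'] assms es by auto
  next
    case False
    then have "e = 1" using es assms(2) by simp
    moreover obtain e' es'' where es': "es' = e' # es''"
      using assms(4) es \<open>e = 1\<close> by (cases es') auto
    ultimately have "e' = - 1" using assms(1,2) es by (auto simp: distinct_adj_Cons)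
    obtain a as' where "as": "as = a # as'" using assms(6) es by (cases "as") auto
    obtain w where "w \<in> word_alg" "j_word j es' as' = j * w"
      using start_j[of as' es''] es' \<open>e' = - 1\<close> "as" assms(5,6) es by auto
    then show ?thesis
      using es es' \<open>e = 1\<close> "as" assms(5) by (force simp: j_letter_def mult.assoc)
  qed
qed

lemma j_word_end:
  assumes "distinct_adj es" "set es \<subseteq> {- 1, 1}" "es \<noteq> []" "es \<noteq> [1]"
    and "set as \<subseteq> B" "length as = length es" "B \<subseteq> C"
  shows "\<exists>w\<in>word_alg. j_word j es as = w * j \<or> (\<exists>a\<in>B. j_word j es as = w * j * a * (1 - j))"
  using assms
proof (induction es arbitrary: "as")
  case Nil
  then show ?case by simp
next
  case (Cons e es)
  obtain a as' where "as": "as = a # as'" using Cons.prems by (cases "as") auto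
  have a: "a \<in> B" "a \<in> word_alg" using "as" Cons.prems C_in_word_alg by auto
  consider "es = []" | "es = [1]" | "es \<noteq> []" "es \<noteq> [1]" by blast
  then show ?case
  proof cases
    case 1
    then show ?thesis
      using Cons.prems one_in_word_alg by (auto simp: j_letter_def intro!: bexI[of _ 1])
  next
    case 2
    then have "j_word j (e # es) as = 1 * j * a * (1 - j)"
      using Cons.prems "as" by (auto simp: j_letter_def)
    then show ?thesis using one_in_word_alg a by blast
  next
    case 3
    then obtain w where w: "w \<in> word_alg" "j_word j es as' = w * j \<or>
        (\<exists>a\<in>B. j_word j es as' = w * j * a * (1 - j))"
      using Cons.IH[of as'] Cons.prems "as" by (auto simp: distinct_adj_Cons)
    let ?w = "j_letter j e * a * w"
    have "?w \<in> word_alg" using w a by (intro word_alg_mult j_letter_in_word_alg)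
    moreover have "j_word j (e # es) as = j_letter j e * a * j_word j es as'"
      using 3 "as" by (cases es) auto
    moreover have "j_letter j e * a * (w * j) = ?w * j"
      "j_letter j e * a * (w * j * a' * (1 - j)) = ?w * j * a' * (1 - j)" for a'
      by (simp_all add: mult.assoc)
    ultimately show ?thesis using w(2) by (elim disjE bexE) (rule bexI[of _ ?w]; auto)+
  qed
qed

text \<open>The two outer copies of \<open>j\<close> isolate the factor
  \<open>\<psi>(a (1 - j) b) = \<phi>(a b) - \<phi>(a) \<phi>(b)\<close>.\<close>

lemma psi_gap:
  assumes "a \<in> C" "b \<in> C" "\<phi> (a * b) = \<phi> a * \<phi> b" "s \<in> word_alg" "t \<in> word_alg"
  shows "\<psi> (s * j * a * (1 - j) * b * j * t) = 0"
proof -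
  have ab: "a \<in> word_alg" "b \<in> word_alg" "a * b \<in> C" using assms C_in_word_alg C_mult by auto
  have "\<psi> (a * (1 - j) * b) = \<psi> (a * b) - \<psi> (a * j * b)"
    by (simp add: algebra_simps psi_diff)
  also have "\<dots> = 0" using psi_mult_j_mult ab psi_C assms by simp
  finally have 0: "\<psi> (a * (1 - j) * b) = 0" .
  have "a * (1 - j) * b \<in> word_alg" using ab jperp_in_word_alg word_alg_mult by blast
  then have "\<psi> (s * j * (a * (1 - j) * b) * j * t) = 0"
    using psi_mult_j_mult word_alg_mult assms j_in_word_alg 0 by simp
  then show ?thesis by (simp add: mult.assoc)
qed

context
  fixes B B' :: "'a set"
  assumes B: "B \<subseteq> C" and B': "B' \<subseteq> C"
    and factor: "\<And>a b. a \<in> B \<Longrightarrow> b \<in> B' \<Longrightarrow> \<phi> (a * b) = \<phi> a * \<phi> b"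
begin

text \<open>By induction on the generation of \<open>\<J>\<^sub>a(B')\<close>.  The arbitrary factor \<open>t\<close> makes the
  statement stable under products, since only the first generator in \<open>y\<close> meets the gap \<open>1 - j\<close>.\<close>

lemma psi_gap_right:
  assumes y: "y \<in> Ja_alg scale j B'" and a: "a \<in> B" and s: "s \<in> word_alg" and t: "t \<in> word_alg"
  shows "\<psi> (s * j * a * (1 - j) * y * t) = 0"
proof -
  define Y where "Y = {y \<in> word_alg. \<forall>t\<in>word_alg. \<psi> (s * j * a * (1 - j) * y * t) = 0}"
  have "Ja_alg scale j B' \<subseteq> Y"
    unfolding Ja_alg_def
  proof (rule hull_minimal)
    show "subalgebra scale Y"
      using word_alg_subalgebra
      by (auto simp: Y_def subalgebra_def subspace_def psi_zero psi_add psi_scale distrib_left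
          distrib_right scale_mult_left scale_mult_right mult.assoc)
    show "{j_word j es as | es as. set es \<subseteq> {- 1, 1} \<and> set as \<subseteq> B' \<and> length as = length es \<and>
        distinct_adj es \<and> es \<noteq> [] \<and> es \<noteq> [1]} \<subseteq> Y"
    proof clarify
      fix es :: "int list" and "as" :: "'a list"
      assume *: "set es \<subseteq> {- 1, 1}" "set as \<subseteq> B'" "length as = length es"
        "distinct_adj es" "es \<noteq> []" "es \<noteq> [1]"
      let ?y = "j_word j es as"
      have "?y \<in> word_alg" using * B' by (intro j_word_in_word_alg) auto
      moreover have "\<psi> (s * j * a * (1 - j) * ?y * t) = 0" if t: "t \<in> word_alg" for t
      proof -
        obtain w where "w \<in> word_alg" "?y = j * w \<or> (\<exists>b\<in>B'. ?y = (1 - j) * b * j * w)"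
          using j_word_start[of es "as" B'] * B' by blast
        then consider "?y = j * w" | b where "b \<in> B'" "?y = (1 - j) * b * j * w" by blast
        then show ?thesis
        proof cases
          case 1
          then show ?thesis
            by (simp add: mult.assoc left_diff_distrib j_mult_j psi_zero)
        next
          case 2
          have "s * j * a * (1 - j) * ?y * t = s * j * a * (1 - j) * b * j * (w * t)"
            using 2 by (simp add: mult.assoc left_diff_distrib right_diff_distrib j_mult_j)
          then show ?thesis
            using psi_gap[of a b s "w * t"] 2 a B B' factor s t \<open>w \<in> word_alg\<close> word_alg_mult by auto
        qed
      qed
      ultimately show "?y \<in> Y" by (simp add: Y_def)
    qed
  qed
  then show ?thesis using y t by (auto simp: Y_def)
qed

text \<open>The mirror image: a product of generators meets the gap with its last generator only, so an
  arbitrary factor \<open>s\<close> on the left is carried through the induction.  A generator ending in \<open>j\<close>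
  annihilates \<open>1 - j\<close>, and one ending in \<open>j a (1 - j)\<close> leads back to \<open>psi_gap_right\<close>.\<close>

lemma psi_gap_both:
  assumes x: "x \<in> Ja_alg scale j B" and y: "y \<in> Ja_alg scale j B'" and t: "t \<in> word_alg"
  shows "\<psi> (x * (1 - j) * y * t) = 0"
proof -
  define X where "X = {x \<in> word_alg. \<forall>s\<in>word_alg. \<psi> (s * x * (1 - j) * y * t) = 0}"
  have "Ja_alg scale j B \<subseteq> X"
    unfolding Ja_alg_def
  proof (rule hull_minimal)
    have "\<psi> (s * (x * x') * (1 - j) * y * t) = 0" if "s \<in> word_alg" "x \<in> word_alg" "x' \<in> X" for s x x'
    proof -
      have "s * x \<in> word_alg" using word_alg_mult that by blast
      then have "\<psi> ((s * x) * x' * (1 - j) * y * t) = 0" using that by (simp only: X_def mem_Collect_eq)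
      then show ?thesis by (simp add: mult.assoc)
    qed
    moreover have "subspace X"
      using word_alg_subspace
      by (auto simp: X_def subspace_def psi_zero psi_add psi_scale distrib_left
          distrib_right scale_mult_left scale_mult_right)
    ultimately show "subalgebra scale X"
      unfolding subalgebra_def by (auto simp: X_def word_alg_mult)
    show "{j_word j es as | es as. set es \<subseteq> {- 1, 1} \<and> set as \<subseteq> B \<and> length as = length es \<and>
        distinct_adj es \<and> es \<noteq> [] \<and> es \<noteq> [1]} \<subseteq> X"
    proof clarify
      fix es :: "int list" and "as" :: "'a list"
      assume *: "set es \<subseteq> {- 1, 1}" "set as \<subseteq> B" "length as = length es"
        "distinct_adj es" "es \<noteq> []" "es \<noteq> [1]"
      let ?x = "j_word j es as"
      have "?x \<in> word_alg" using * B by (intro j_word_in_word_alg) auto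
      moreover have "\<psi> (s * ?x * (1 - j) * y * t) = 0" if s: "s \<in> word_alg" for s
      proof -
        obtain w where w: "w \<in> word_alg" "?x = w * j \<or> (\<exists>a\<in>B. ?x = w * j * a * (1 - j))"
          using j_word_end[of es "as" B] * B by blast
        then consider "?x = w * j" | a where "a \<in> B" "?x = w * j * a * (1 - j)" by blast
        then show ?thesis
        proof cases
          case 1
          then show ?thesis
            by (simp add: mult.assoc left_diff_distrib right_diff_distrib j_mult_j psi_zero)
        next
          case 2
          have "s * ?x * (1 - j) * y * t = (s * w) * j * a * (1 - j) * y * t"
            using 2 by (simp add: mult.assoc left_diff_distrib right_diff_distrib j_mult_j)
          then show ?thesis
            using psi_gap_right[OF y \<open>a \<in> B\<close> _ t, of "s * w"] word_alg_mult s w by simp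
        qed
      qed
      ultimately show "?x \<in> X" by (simp add: X_def)
    qed
  qed
  then have "\<psi> (1 * x * (1 - j) * y * t) = 0"
    using x one_in_word_alg unfolding X_def by blast
  then show ?thesis by simp
qed

lemma psi_mult_Ja_alg:
  assumes x: "x \<in> Ja_alg scale j B" and y: "y \<in> Ja_alg scale j B'" and t: "t \<in> word_alg"
  shows "\<psi> (x * (y * t)) = \<psi> x * \<psi> (y * t)"
proof -
  have "x \<in> word_alg" "y * t \<in> word_alg" using x y t Ja_alg_in_word_alg B B' word_alg_mult by blast+
  moreover have "x * (y * t) = x * j * (y * t) + x * (1 - j) * y * t"
    by (simp add: algebra_simps)
  ultimately show ?thesis
    using psi_gap_both[OF x y t] psi_mult_j_mult by (simp add: psi_add)
qed

end

text \<open>Peel off the first factor; only the indices of the first two factors matter, because the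
  remaining product is absorbed into the arbitrary element \<open>t\<close> of \<open>psi_mult_Ja_alg\<close>.\<close>

lemma Ja_alg_multiplicative:
  assumes A: "\<And>i. i \<in> I \<Longrightarrow> A i \<subseteq> C"
    and free: "free scale \<phi> I A"
    and alt: "set is \<subseteq> I" "distinct_adj is" "list_all2 (\<lambda>i x. x \<in> Ja_alg scale j (A i)) is xs"
  shows "\<psi> (prod_list xs) = prod_list (map \<psi> xs) \<and> prod_list xs \<in> word_alg"
  using alt
proof (induction "is" arbitrary: xs)
  case Nil
  then show ?case using psi_C[OF one_in_C] \<phi>_one one_in_word_alg by simp
next
  case (Cons i "is")
  obtain x ys where xs: "xs = x # ys" "x \<in> Ja_alg scale j (A i)"
    "list_all2 (\<lambda>i x. x \<in> Ja_alg scale j (A i)) is ys"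
    using Cons.prems by (auto simp: list_all2_Cons1)
  have ih: "\<psi> (prod_list ys) = prod_list (map \<psi> ys)" "prod_list ys \<in> word_alg"
    using Cons.IH[of ys] Cons.prems xs by (auto simp: distinct_adj_Cons)
  have xT: "x \<in> word_alg" using xs Ja_alg_in_word_alg A Cons.prems by auto
  show ?case
  proof (cases "is")
    case Nil
    then show ?thesis using xs xT by simp
  next
    case (Cons k "is'")
    then obtain y zs where ys: "ys = y # zs" "y \<in> Ja_alg scale j (A k)"
      "list_all2 (\<lambda>i x. x \<in> Ja_alg scale j (A i)) is' zs"
      using xs by (auto simp: list_all2_Cons1)
    have zs: "prod_list zs \<in> word_alg"
    proof -
      have "set zs \<subseteq> word_alg"
        using ys(3)
      proof (rule list_all2_mem_subset)
        fix l assume "l \<in> set is'"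
        then have "l \<in> I" using Cons.prems(1) Cons by auto
        then show "Ja_alg scale j (A l) \<subseteq> word_alg" using Ja_alg_in_word_alg A by simp
      qed
      then show ?thesis by (induction zs) (auto simp: one_in_word_alg word_alg_mult)
    qed
    have ik: "i \<in> I" "k \<in> I" "i \<noteq> k"
      using Cons.prems \<open>is = k # is'\<close> by (auto simp: distinct_adj_Cons)
    have "\<psi> (x * (y * prod_list zs)) = \<psi> x * \<psi> (y * prod_list zs)"
      using psi_mult_Ja_alg[of "A i" "A k" x y] free_mult[OF free ik] A ik xs(2) ys(2) zs by blast
    then show ?thesis using ih xs(1) ys(1) xT word_alg_mult by simp
  qed
qed

end

theorem theorem5p6:
  fixes scale :: "complex \<Rightarrow> 'a::ring_1 \<Rightarrow> 'a"
    and \<phi> \<phi>' \<psi> :: "'a \<Rightarrow> complex"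
    and j :: 'a
    and I :: "'i set"
    and A :: "'i \<Rightarrow> 'a set"
  assumes "infinitesimal_probability_space scale \<phi> \<phi>'"
    and "infinitesimal_idempotent \<phi> j"
    and "\<phi>' j \<noteq> 0"
    and "\<And>a. \<psi> a = \<phi>' (a * j) / \<phi>' j"
    and "\<And>i. i \<in> I \<Longrightarrow> unital_subalgebra scale (A i)"
    and "infinitesimally_free_from scale \<phi> \<phi>' I A j"
  shows "boolean_independent scale \<psi> I (\<lambda>i. (\<lambda>x. j * x * j) ` J_alg scale j (A i)) \<and>
    (free scale \<phi> I A \<longrightarrow> boolean_independent scale \<psi> I (\<lambda>i. Ja_alg scale j (A i)))"
proof -
  let ?C = "unital_subalgebra scale hull (\<Union>i\<in>I. A i)"
  let ?D = "unital_subalgebra scale hull {j}"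
  interpret infinitesimal_probability_space scale \<phi> \<phi>' by fact
  interpret W: free_infinitesimal_idempotent scale \<phi> \<phi>' ?C ?D j
    using assms(2,3,6) by unfold_locales (auto simp: infinitesimally_free_from_def hull_inc)
  have psi: "\<psi> = W.\<psi>"
    using assms(4) by (auto simp: W.\<psi>_def)
  have A: "A i \<subseteq> ?C" if "i \<in> I" for i
    using hull_subset[of "\<Union>i\<in>I. A i" "unital_subalgebra scale"] that by blast
  have "boolean_independent scale \<psi> I (\<lambda>i. (\<lambda>x. j * x * j) ` J_alg scale j (A i))"
    unfolding boolean_independent_def
  proof (intro conjI ballI allI impI)
    fix i assume "i \<in> I"
    then show "subalgebra scale ((\<lambda>x. j * x * j) ` J_alg scale j (A i))"
      using assms(5) W.j_in_J_alg[of "A i"]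
      by (intro W.compression_subalgebra) (auto simp: J_alg_def subalgebra_hull unital_subalgebra_def)
  next
    fix xs assume "alternating I (\<lambda>i. (\<lambda>x. j * x * j) ` J_alg scale j (A i)) xs"
    then obtain "is" where "xs \<noteq> []" and is_I: "set is \<subseteq> I" and
      mem: "list_all2 (\<lambda>i x. x \<in> (\<lambda>x. j * x * j) ` J_alg scale j (A i)) is xs"
      by (auto simp: alternating_def)
    have "set xs \<subseteq> (\<lambda>x. j * x * j) ` W.word_alg"
      using mem
    proof (rule list_all2_mem_subset)
      fix i assume "i \<in> set is"
      then have "J_alg scale j (A i) \<subseteq> W.word_alg" using is_I A by (intro W.J_alg_in_word_alg) auto
      then show "(\<lambda>x. j * x * j) ` J_alg scale j (A i) \<subseteq> (\<lambda>x. j * x * j) ` W.word_alg" by blast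
    qed
    then show "\<psi> (prod_list xs) = prod_list (map \<psi> xs)"
      unfolding psi using W.compression_multiplicative \<open>xs \<noteq> []\<close> by blast
  qed
  moreover have "boolean_independent scale \<psi> I (\<lambda>i. Ja_alg scale j (A i))" if "free scale \<phi> I A"
    unfolding boolean_independent_def alternating_def psi
    using W.Ja_alg_multiplicative[OF A that] by (auto simp: Ja_alg_def subalgebra_hull)
  ultimately show ?thesis by blast
qed

end
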